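(* Let $K$ be a field and let $I=I(G)\subset K[x_1,\ldots,x_n]$ be the edge ideal of a simple graph $G$ on the vertex set $[n]$, such that $I^2$ is not of intersection type. Then for any $k\geq2$, the ideal $I^k$ is not of intersection type.
   Context: A simple graph is a finite graph without loops and multiple edges. The edge ideal $I(G)\subset K[x_1,\ldots,x_n]$ is generated by the monomials $x_ix_j$ with $\{i,j\}$ an edge of $G$. A monomial prime ideal is a prime ideal generated by a subset of the variables. A monomial ideal is of intersection type if it is an intersection of powers (with positive integer exponents) of monomial prime ideals. *)

theory Defs
  imports "HOL-Algebra.Ideal_Product" "HOL-Library.Poly_Mapping"
begin

text \<open>
  Exponent vectors are finitely supported maps from variable indices to \<open>nat\<close>, and polynomials are
  finitely supported maps from exponent vectors to coefficients, multiplied by the convolution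
  product of \<^theory>\<open>HOL-Library.Poly_Mapping\<close>.  The type has a variable for each natural number;
  the carrier below restricts it to \<open>x\<^sub>1, \<dots>, x\<^sub>n\<close>, so that ideals are ideals of
  \<open>K[x\<^sub>1, \<dots>, x\<^sub>n]\<close> itself, where \<open>K\<close> is the type \<open>'k\<close>.
\<close>

type_synonym 'k mpoly = "(nat \<Rightarrow>\<^sub>0 nat) \<Rightarrow>\<^sub>0 'k"

definition mpoly_ring :: "nat \<Rightarrow> 'k::field mpoly ring" where
  "mpoly_ring n =
     \<lparr>carrier = {p. \<forall>m \<in> Poly_Mapping.keys p. Poly_Mapping.keys m \<subseteq> {1..n}},
      mult = (*), one = 1, zero = 0, add = (+)\<rparr>"

definition monom :: "(nat \<Rightarrow>\<^sub>0 nat) \<Rightarrow> 'k::field mpoly" where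
  "monom m = Poly_Mapping.single m 1"

definition var :: "nat \<Rightarrow> 'k::field mpoly" where
  "var i = monom (Poly_Mapping.single i 1)"

lemma mpoly_ring_cring: "cring (mpoly_ring n :: 'k::field mpoly ring)"
proof (rule cringI)
  let ?R = "mpoly_ring n :: 'k mpoly ring"
  show "abelian_group ?R"
  proof (rule abelian_groupI)
    fix x y assume "x \<in> carrier ?R" "y \<in> carrier ?R"
    then show "x \<oplus>\<^bsub>?R\<^esub> y \<in> carrier ?R"
      using Poly_Mapping.keys_add[of x y] by (auto simp: mpoly_ring_def)
  next
    fix x assume x: "x \<in> carrier ?R"
    show "\<exists>y \<in> carrier ?R. y \<oplus>\<^bsub>?R\<^esub> x = \<zero>\<^bsub>?R\<^esub>"
      by (rule bexI[of _ "- x"])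
        (use x in \<open>auto simp: mpoly_ring_def in_keys_iff\<close>)
  qed (auto simp: mpoly_ring_def algebra_simps)
  show "comm_monoid ?R"
  proof (rule comm_monoidI)
    fix x y assume xy: "x \<in> carrier ?R" "y \<in> carrier ?R"
    have "Poly_Mapping.keys m \<subseteq> {1..n}" if m: "m \<in> Poly_Mapping.keys (x * y)" for m
    proof -
      obtain a b where "m = a + b" "a \<in> Poly_Mapping.keys x" "b \<in> Poly_Mapping.keys y"
        using m Poly_Mapping.keys_mult[of x y] by blast
      then show ?thesis
        using xy Poly_Mapping.keys_add[of a b] by (fastforce simp: mpoly_ring_def)
    qed
    then show "x \<otimes>\<^bsub>?R\<^esub> y \<in> carrier ?R"
      by (auto simp: mpoly_ring_def)
  qed (auto simp: mpoly_ring_def algebra_simps)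
qed (auto simp: mpoly_ring_def algebra_simps)

definition simple_graph :: "nat set \<Rightarrow> nat set set \<Rightarrow> bool" where
  "simple_graph V E \<longleftrightarrow> finite V \<and> (\<forall>e \<in> E. e \<subseteq> V \<and> card e = 2)"

definition edge_ideal :: "nat \<Rightarrow> nat set set \<Rightarrow> 'k::field mpoly set" where
  "edge_ideal n E = genideal (mpoly_ring n) {var i * var j | i j. {i, j} \<in> E}"

definition monomial_ideal :: "nat \<Rightarrow> 'k::field mpoly set \<Rightarrow> bool" where
  "monomial_ideal n I \<longleftrightarrow>
     (\<exists>M. (\<forall>m \<in> M. Poly_Mapping.keys m \<subseteq> {1..n}) \<and> I = genideal (mpoly_ring n) (monom ` M))"

definition monomial_prime :: "nat \<Rightarrow> 'k::field mpoly set \<Rightarrow> bool" where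
  "monomial_prime n P \<longleftrightarrow>
     primeideal P (mpoly_ring n) \<and> (\<exists>S \<subseteq> {1..n}. P = genideal (mpoly_ring n) (var ` S))"

text \<open>
  Multiplication in \<^const>\<open>ideals_set\<close> is the product of ideals, so \<open>[^]\<close> there is the power of
  an ideal.  Intersections are finite and nonempty.  The zero ideal, generated by the empty set of
  variables, is a monomial prime ideal.
\<close>

definition intersection_type :: "nat \<Rightarrow> 'k::field mpoly set \<Rightarrow> bool" where
  "intersection_type n I \<longleftrightarrow> monomial_ideal n I \<and>
     (\<exists>F. finite F \<and> F \<noteq> {} \<and> (\<forall>(P, a) \<in> F. monomial_prime n P \<and> a \<ge> 1) \<and>
          I = (\<Inter>(P, a) \<in> F. P [^]\<^bsub>ideals_set (mpoly_ring n)\<^esub> (a::nat)))"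

end

theory Submission
  imports Defs "HOL-Library.Set_Algebras"
begin

text \<open>
  Call a triangle undominated if some non-isolated vertex \<open>v\<close> outside it is adjacent to none of
  its vertices.  Both halves of the argument go through this obstruction: its absence makes \<open>I\<^sup>2\<close>
  of intersection type (\<open>intersection_type_square_of_no_undominated_triangle\<close>), and its presence
  prevents \<open>I\<^sup>k\<close> from being so for every \<open>k \<ge> 2\<close>
  (\<open>not_intersection_type_power_of_undominated_triangle\<close>).

  All ideals involved are spanned by monomials, so everything reduces to sets of exponent vectors:
  products of ideals become sums of such sets, and the power \<open>P\<^sup>a\<close> of the prime generated by the
  variables in \<open>S\<close> consists of the exponent vectors whose total weight on \<open>S\<close> is at least \<open>a\<close>.
  An edge monomial has weight at least \<open>1\<close> on a vertex cover and weight \<open>2\<close> on the set \<open>V\<close> of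
  non-isolated vertices.  Hence \<open>I\<^sup>2\<close> lies in \<open>P\<^sub>C\<^sup>2\<close> for all vertex covers \<open>C\<close>
  and in \<open>P\<^sub>V\<^sup>4\<close>.  Without an undominated triangle the intersection of these ideals is \<open>I\<^sup>2\<close>:
  the support of a monomial in it that no product of two edges divides would contain a triangle
  with all exponents \<open>1\<close> and a further non-isolated vertex, and an edge from that vertex to the
  triangle, multiplied by the opposite side, would divide the monomial
  (\<open>edge_square_mem_of_weights\<close>).

  Conversely, let \<open>x y z\<close> be a triangle undominated because of \<open>v\<close>, and put
  \<open>u = x y z v (x y)\<^bsup>k-2\<^esup>\<close>.  Every power \<open>P\<^sub>S\<^sup>a\<close> with \<open>a \<ge> 1\<close> that contains \<open>I\<^sup>k\<close>
  contains the \<open>k\<close>-th powers of the edges, which bounds \<open>a\<close> enough for \<open>u\<close> to lie in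
  \<open>P\<^sub>S\<^sup>a\<close>.  So if \<open>I\<^sup>k\<close> were an intersection of such powers, it would contain \<open>u\<close>.  But the
  edges available inside the support of \<open>u\<close> are the sides of the triangle, and \<open>k\<close> of them need
  weight \<open>2 k\<close> on \<open>{x, y, z}\<close>, where \<open>u\<close> has only \<open>2 k - 1\<close>.
\<close>

section \<open>Ideals spanned by monomials\<close>

abbreviation expo :: "(nat \<Rightarrow>\<^sub>0 nat) \<Rightarrow> nat \<Rightarrow> nat" where
  "expo \<equiv> Poly_Mapping.lookup"

definition exponents :: "nat \<Rightarrow> (nat \<Rightarrow>\<^sub>0 nat) set" where
  "exponents n = {m. Poly_Mapping.keys m \<subseteq> {1..n}}"

definition monomial_span :: "(nat \<Rightarrow>\<^sub>0 nat) set \<Rightarrow> 'k::field mpoly set" where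
  "monomial_span U = {p. Poly_Mapping.keys p \<subseteq> U}"

lemma exponents_add: "a \<in> exponents n \<Longrightarrow> b \<in> exponents n \<Longrightarrow> a + b \<in> exponents n"
  using Poly_Mapping.keys_add[of a b] by (auto simp: exponents_def)

lemma exponents_addD: "a + b \<in> exponents n \<Longrightarrow> a \<in> exponents n \<and> b \<in> exponents n"
  by (auto simp: exponents_def subset_iff in_keys_iff lookup_add)

lemma carrier_mpoly_ring: "carrier (mpoly_ring n) = monomial_span (exponents n)"
  by (auto simp: mpoly_ring_def monomial_span_def exponents_def)

lemma mpoly_ring_ops:
  "p \<otimes>\<^bsub>mpoly_ring n\<^esub> q = p * q" "p \<oplus>\<^bsub>mpoly_ring n\<^esub> q = p + q"
  "\<zero>\<^bsub>mpoly_ring n\<^esub> = 0"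
  by (simp_all add: mpoly_ring_def)

lemma single_in_monomial_span: "m \<in> U \<Longrightarrow> Poly_Mapping.single m c \<in> monomial_span U"
  by (auto simp: monomial_span_def)

lemma monomial_span_subset_iff:
  "(monomial_span U :: 'k::field mpoly set) \<subseteq> monomial_span V \<longleftrightarrow> U \<subseteq> V"
proof
  assume *: "(monomial_span U :: 'k mpoly set) \<subseteq> monomial_span V"
  show "U \<subseteq> V"
  proof
    fix m assume "m \<in> U"
    then have "(Poly_Mapping.single m 1 :: 'k mpoly) \<in> monomial_span V"
      using * single_in_monomial_span by blast
    then show "m \<in> V"
      by (auto simp: monomial_span_def)
  qed
qed (auto simp: monomial_span_def)

lemma monomial_span_add:
  "p \<in> monomial_span U \<Longrightarrow> q \<in> monomial_span U \<Longrightarrow> p + q \<in> monomial_span U"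
  using Poly_Mapping.keys_add[of p q] by (auto simp: monomial_span_def)

lemma monomial_span_diff:
  "p \<in> monomial_span U \<Longrightarrow> q \<in> monomial_span U \<Longrightarrow> p - q \<in> monomial_span U"
  using Poly_Mapping.keys_diff[of p q] by (auto simp: monomial_span_def)

lemma monomial_span_mult:
  "p \<in> monomial_span U \<Longrightarrow> q \<in> monomial_span V \<Longrightarrow> p * q \<in> monomial_span (U + V)"
  using Poly_Mapping.keys_mult[of p q] by (fastforce simp: monomial_span_def set_plus_def)

text \<open>Every polynomial is the sum of its terms; this is how a span is shown to be contained in an
  ideal or a product of ideals, which are given by closure under sums.\<close>

lemma monomial_span_subset_of_singles:
  fixes H :: "'k::field mpoly set"
  assumes "0 \<in> H" and add: "\<And>p q. p \<in> H \<Longrightarrow> q \<in> H \<Longrightarrow> p + q \<in> H"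
    and single: "\<And>m c. m \<in> U \<Longrightarrow> Poly_Mapping.single m c \<in> H"
  shows "monomial_span U \<subseteq> H"
proof
  fix p :: "'k mpoly" assume "p \<in> monomial_span U"
  then have "Poly_Mapping.keys p \<subseteq> U"
    by (simp add: monomial_span_def)
  then show "p \<in> H"
  proof (induction "card (Poly_Mapping.keys p)" arbitrary: p)
    case 0
    then have "p = 0"
      by simp
    then show ?case using assms(1) by simp
  next
    case (Suc r)
    then obtain m where m: "m \<in> Poly_Mapping.keys p"
      by (metis card_eq_0_iff equals0I nat.simps(3))
    define q where "q = p - Poly_Mapping.single m (Poly_Mapping.lookup p m)"
    have q: "Poly_Mapping.keys q = Poly_Mapping.keys p - {m}"
      by (auto simp: q_def in_keys_iff lookup_minus lookup_single when_def split: if_splits)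
    then have "q \<in> H"
      using Suc m by (intro Suc.hyps(1)) auto
    moreover have "p = q + Poly_Mapping.single m (Poly_Mapping.lookup p m)"
      by (simp add: q_def)
    ultimately show ?case
      using add single m Suc.prems by (metis subsetD)
  qed
qed

text \<open>A term with exponent \<open>u + v\<close> is a product of terms with exponents \<open>u\<close> and \<open>v\<close>, so sums of
  products give the whole span.\<close>

lemma ideal_prod_monomial_span:
  "ideal_prod (mpoly_ring n) (monomial_span U) (monomial_span V) =
    (monomial_span (U + V) :: 'k::field mpoly set)" (is "?P = _")
proof
  show "?P \<subseteq> monomial_span (U + V)"
  proof
    fix p assume "p \<in> ?P"
    then show "p \<in> monomial_span (U + V)"
      by induction (auto simp: mpoly_ring_ops intro: monomial_span_mult monomial_span_add)
  qed
  show "monomial_span (U + V) \<subseteq> ?P"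
  proof (rule monomial_span_subset_of_singles)
    have "0 \<in> (monomial_span W :: 'k mpoly set)" for W
      by (simp add: monomial_span_def)
    then show "0 \<in> ?P"
      using ideal_prod.prod[of "0 :: 'k mpoly" "monomial_span U" 0 "monomial_span V" "mpoly_ring n"]
      by (simp add: mpoly_ring_ops)
  next
    fix p q assume "p \<in> ?P" "q \<in> ?P"
    then show "p + q \<in> ?P"
      using ideal_prod.sum[of p "mpoly_ring n" _ _ q] by (simp add: mpoly_ring_ops)
  next
    fix m and c :: 'k assume "m \<in> U + V"
    then obtain u v where uv: "u \<in> U" "v \<in> V" "m = u + v"
      by (auto simp: set_plus_def)
    have "Poly_Mapping.single u c \<otimes>\<^bsub>mpoly_ring n\<^esub> Poly_Mapping.single v 1 \<in> ?P"
      using uv by (intro ideal_prod.prod single_in_monomial_span)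
    then show "Poly_Mapping.single m c \<in> ?P"
      by (simp add: mpoly_ring_ops mult_single uv)
  qed
qed

text \<open>The zeroth power is \<^term>\<open>exponents n\<close> because the zeroth power of an ideal is the whole
  ring.\<close>

primrec sumset_power :: "nat \<Rightarrow> (nat \<Rightarrow>\<^sub>0 nat) set \<Rightarrow> nat \<Rightarrow> (nat \<Rightarrow>\<^sub>0 nat) set" where
  "sumset_power n U 0 = exponents n"
| "sumset_power n U (Suc k) = sumset_power n U k + U"

lemma sumset_power_subset: "U \<subseteq> exponents n \<Longrightarrow> sumset_power n U k \<subseteq> exponents n"
  by (induction k) (auto simp: set_plus_def intro!: exponents_add)

lemma monomial_span_power:
  "(monomial_span U :: 'k::field mpoly set) [^]\<^bsub>ideals_set (mpoly_ring n)\<^esub> (k::nat) =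
    monomial_span (sumset_power n U k)"
proof (induction k)
  case 0
  show ?case by (simp add: nat_pow_def ideals_set_def carrier_mpoly_ring)
next
  case (Suc k)
  then show ?case
    by (simp add: nat_pow_def ideals_set_def flip: ideal_prod_monomial_span[of n])
qed

lemma monomial_span_ideal:
  fixes U :: "(nat \<Rightarrow>\<^sub>0 nat) set"
  assumes U: "U \<subseteq> exponents n" "U + exponents n \<subseteq> U"
  shows "ideal (monomial_span U :: 'k::field mpoly set) (mpoly_ring n)"
proof (rule idealI)
  let ?R = "mpoly_ring n :: 'k mpoly ring"
  interpret cring ?R by (rule mpoly_ring_cring)
  show "ring ?R" ..
  show "subgroup (monomial_span U) (add_monoid ?R)"
  proof (rule add.subgroupI)
    show "monomial_span U \<subseteq> carrier ?R"
      by (simp add: carrier_mpoly_ring monomial_span_subset_iff U)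
    have "0 \<in> (monomial_span U :: 'k mpoly set)"
      by (simp add: monomial_span_def)
    then show "(monomial_span U :: 'k mpoly set) \<noteq> {}"
      by blast
  next
    fix p :: "'k mpoly" assume p: "p \<in> monomial_span U"
    have m: "- p \<in> monomial_span U"
      using p by (auto simp: monomial_span_def in_keys_iff)
    have "p \<in> carrier ?R" "- p \<in> carrier ?R"
      using p m U by (auto simp: carrier_mpoly_ring monomial_span_def)
    then have "\<ominus>\<^bsub>?R\<^esub> p = - p"
      by (intro minus_equality) (auto simp: mpoly_ring_ops)
    with m show "\<ominus>\<^bsub>?R\<^esub> p \<in> monomial_span U" by simp
  next
    fix p q :: "'k mpoly" assume "p \<in> monomial_span U" "q \<in> monomial_span U"
    then show "p \<oplus>\<^bsub>?R\<^esub> q \<in> monomial_span U"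
      by (simp add: mpoly_ring_ops monomial_span_add)
  qed
next
  fix p q :: "'k mpoly" assume p: "p \<in> monomial_span U" and q: "q \<in> carrier (mpoly_ring n)"
  have "p * q \<in> monomial_span (U + exponents n)"
    using p q by (intro monomial_span_mult) (simp_all add: carrier_mpoly_ring)
  then have pq: "p * q \<in> monomial_span U"
    using U monomial_span_subset_iff by blast
  then show "p \<otimes>\<^bsub>mpoly_ring n\<^esub> q \<in> monomial_span U"
    by (simp add: mpoly_ring_ops)
  show "q \<otimes>\<^bsub>mpoly_ring n\<^esub> p \<in> monomial_span U"
    using pq by (simp add: mpoly_ring_ops mult.commute)
qed

lemma genideal_monom:
  assumes M: "M \<subseteq> exponents n"
  shows "genideal (mpoly_ring n) (monom ` M) =
    (monomial_span (M + exponents n) :: 'k::field mpoly set)" (is "?G = _")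
proof
  let ?R = "mpoly_ring n :: 'k mpoly ring"
  interpret cring ?R by (rule mpoly_ring_cring)
  have zero: "(0 :: nat \<Rightarrow>\<^sub>0 nat) \<in> exponents n"
    by (simp add: exponents_def)
  have sub: "M \<subseteq> M + exponents n"
    using zero by (force simp: set_plus_def)
  have ideal: "ideal (monomial_span (M + exponents n)) ?R"
  proof (rule monomial_span_ideal)
    show "M + exponents n \<subseteq> exponents n"
      using M by (auto simp: set_plus_def intro: exponents_add)
    have "exponents n + exponents n \<subseteq> exponents n"
      by (auto simp: set_plus_def intro: exponents_add)
    then show "M + exponents n + exponents n \<subseteq> M + exponents n"
      by (metis add.assoc set_plus_mono2 order_refl)
  qed
  show "?G \<subseteq> monomial_span (M + exponents n)"
    using sub by (intro genideal_minimal[OF ideal]) (auto simp: monom_def single_in_monomial_span)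
  have MR: "monom ` M \<subseteq> carrier ?R"
    using M by (auto simp: monom_def carrier_mpoly_ring single_in_monomial_span)
  interpret G: ideal ?G ?R
    by (rule genideal_ideal[OF MR])
  show "monomial_span (M + exponents n) \<subseteq> ?G"
  proof (rule monomial_span_subset_of_singles)
    show "0 \<in> ?G"
      using G.zero_closed by (simp add: mpoly_ring_ops)
    show "p + q \<in> ?G" if "p \<in> ?G" "q \<in> ?G" for p q
      using G.a_closed[OF that] by (simp add: mpoly_ring_ops)
    fix m and c :: 'k assume "m \<in> M + exponents n"
    then obtain u v where uv: "u \<in> M" "v \<in> exponents n" "m = u + v"
      by (auto simp: set_plus_def)
    have "monom u \<in> ?G"
      using genideal_self[OF MR] uv by blast
    then have "monom u \<otimes>\<^bsub>?R\<^esub> Poly_Mapping.single v c \<in> ?G"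
      using uv by (intro G.I_r_closed) (simp_all add: carrier_mpoly_ring single_in_monomial_span)
    then show "Poly_Mapping.single m c \<in> ?G"
      by (simp add: mpoly_ring_ops monom_def mult_single uv)
  qed
qed

section \<open>Monomial primes and their powers\<close>

definition weight :: "nat set \<Rightarrow> (nat \<Rightarrow>\<^sub>0 nat) \<Rightarrow> nat" where
  "weight S m = (\<Sum>i\<in>S. expo m i)"

lemma weight_add: "weight S (a + b) = weight S a + weight S b"
  by (simp add: weight_def lookup_add sum.distrib)

definition weight_ge :: "nat \<Rightarrow> nat set \<Rightarrow> nat \<Rightarrow> (nat \<Rightarrow>\<^sub>0 nat) set" where
  "weight_ge n S a = {m \<in> exponents n. a \<le> weight S m}"

definition variable_ideal :: "nat \<Rightarrow> nat set \<Rightarrow> 'k::field mpoly set" where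
  "variable_ideal n S = genideal (mpoly_ring n) (var ` S)"

lemma peel_monomial:
  assumes m: "m \<in> exponents n" and le: "\<And>i. expo d i \<le> expo m i"
  obtains c where "m = d + c" "c \<in> exponents n" "d \<in> exponents n"
proof
  show eq: "m = d + (m - d)"
    using le by (intro poly_mapping_eqI) (simp add: lookup_add lookup_minus)
  show "m - d \<in> exponents n" "d \<in> exponents n"
    using exponents_addD m eq by metis+
qed

lemma variable_ideal_eq:
  assumes S: "S \<subseteq> {1..n}"
  shows "variable_ideal n S = (monomial_span (weight_ge n S 1) :: 'k::field mpoly set)"
proof -
  let ?M = "(\<lambda>i. Poly_Mapping.single i (1::nat)) ` S"
  have fin: "finite S"
    using S finite_subset by blast
  have M: "?M \<subseteq> exponents n"
    using S by (auto simp: exponents_def)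
  have "?M + exponents n = weight_ge n S 1"
  proof
    show "?M + exponents n \<subseteq> weight_ge n S 1"
    proof
      fix m assume "m \<in> ?M + exponents n"
      then obtain i c where ic: "i \<in> S" "c \<in> exponents n" "m = Poly_Mapping.single i 1 + c"
        by (auto simp: set_plus_def)
      have "expo m i \<le> weight S m"
        unfolding weight_def using fin ic by (intro member_le_sum) auto
      then show "m \<in> weight_ge n S 1"
        using ic M by (auto simp: weight_ge_def lookup_add intro!: exponents_add)
    qed
    show "weight_ge n S 1 \<subseteq> ?M + exponents n"
    proof
      fix m assume m: "m \<in> weight_ge n S 1"
      then have "weight S m \<noteq> 0"
        by (auto simp: weight_ge_def)
      then obtain i where i: "i \<in> S" "expo m i \<noteq> 0"
        unfolding weight_def by (meson sum.neutral)
      from m have "m \<in> exponents n"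
        by (simp add: weight_ge_def)
      then obtain c where "m = Poly_Mapping.single i 1 + c" "c \<in> exponents n"
        by (rule peel_monomial[where d = "Poly_Mapping.single i 1"])
          (use i in \<open>auto simp: lookup_single when_def\<close>)
      then show "m \<in> ?M + exponents n"
        using i by (auto simp: set_plus_def)
    qed
  qed
  moreover have "var ` S = (monom ` ?M :: 'k mpoly set)"
    by (simp add: var_def image_image)
  ultimately show ?thesis
    by (simp only: variable_ideal_def genideal_monom[OF M])
qed

text \<open>A monomial of positive weight on \<open>S\<close> is divisible by a variable in \<open>S\<close>; splitting one off
  lowers the weight by exactly \<open>1\<close>.\<close>

lemma sumset_power_weight_ge:
  assumes S: "S \<subseteq> {1..n}"
  shows "sumset_power n (weight_ge n S 1) a = weight_ge n S a"
proof (induction a)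
  case 0
  show ?case by (simp add: weight_ge_def)
next
  case (Suc a)
  have "weight_ge n S a + weight_ge n S 1 = weight_ge n S (Suc a)"
  proof
    show "weight_ge n S a + weight_ge n S 1 \<subseteq> weight_ge n S (Suc a)"
      by (fastforce simp: set_plus_def weight_ge_def weight_add intro: exponents_add)
    show "weight_ge n S (Suc a) \<subseteq> weight_ge n S a + weight_ge n S 1"
    proof
      fix m assume m: "m \<in> weight_ge n S (Suc a)"
      then have "weight S m \<noteq> 0"
        by (auto simp: weight_ge_def)
      then obtain i where i: "i \<in> S" "expo m i \<noteq> 0"
        unfolding weight_def by (meson sum.neutral)
      let ?d = "Poly_Mapping.single i (1::nat)"
      from m have "m \<in> exponents n"
        by (simp add: weight_ge_def)
      then obtain c where c: "m = ?d + c" "c \<in> exponents n" "?d \<in> exponents n"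
        by (rule peel_monomial[where d = ?d]) (use i in \<open>auto simp: lookup_single when_def\<close>)
      have "weight S ?d = 1"
        using S i finite_subset[of S "{1..n}"] by (simp add: weight_def lookup_single when_def)
      then have "c \<in> weight_ge n S a" "?d \<in> weight_ge n S 1"
        using m c by (auto simp: weight_ge_def weight_add)
      then show "m \<in> weight_ge n S a + weight_ge n S 1"
        using c by (auto simp: set_plus_def add.commute)
    qed
  qed
  with Suc show ?case by simp
qed

lemma variable_ideal_power:
  assumes "S \<subseteq> {1..n}"
  shows "variable_ideal n S [^]\<^bsub>ideals_set (mpoly_ring n)\<^esub> (a::nat) =
    monomial_span (weight_ge n S a)"
  by (simp only: variable_ideal_eq[OF assms] monomial_span_power sumset_power_weight_ge[OF assms])

lemma monomial_prime_iff:
  "monomial_prime n P \<longleftrightarrow> primeideal P (mpoly_ring n) \<and> (\<exists>S \<subseteq> {1..n}. P = variable_ideal n S)"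
  by (simp add: monomial_prime_def variable_ideal_def)

lemma split_by_exponents:
  fixes p :: "'k::field mpoly"
  obtains p0 where "Poly_Mapping.keys p0 = Poly_Mapping.keys p - U" "p - p0 \<in> monomial_span U"
proof
  let ?p0 = "Poly_Mapping.mapp (\<lambda>m c. if m \<in> U then 0 else c) p"
  show "Poly_Mapping.keys ?p0 = Poly_Mapping.keys p - U"
    by (auto simp: in_keys_iff lookup_mapp when_def split: if_splits)
  show "p - ?p0 \<in> monomial_span U"
    by (auto simp: monomial_span_def in_keys_iff lookup_minus lookup_mapp when_def split: if_splits)
qed

text \<open>Modulo the ideal, a polynomial is represented by its part free of the variables in \<open>S\<close>; such
  parts are closed under products, and the polynomials have no zero divisors.\<close>

lemma monomial_prime_variable_ideal:
  assumes S: "S \<subseteq> {1..n}"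
  shows "monomial_prime n (variable_ideal n S :: 'k::field mpoly set)"
proof -
  let ?R = "mpoly_ring n :: 'k mpoly ring"
  let ?U = "weight_ge n S 1"
  have Uex: "?U \<subseteq> exponents n"
    by (auto simp: weight_ge_def)
  have Ucl: "?U + exponents n \<subseteq> ?U"
    by (auto simp: weight_ge_def set_plus_def weight_add intro: exponents_add)
  have ideal: "ideal (monomial_span ?U) ?R"
    using Uex Ucl by (rule monomial_span_ideal)
  have "primeideal (monomial_span ?U) ?R"
  proof (rule primeidealI[OF ideal mpoly_ring_cring])
    have "0 \<in> exponents n" "0 \<notin> ?U"
      by (auto simp: exponents_def weight_ge_def weight_def)
    then show "carrier ?R \<noteq> monomial_span ?U"
      by (metis carrier_mpoly_ring monomial_span_subset_iff order_refl subsetD)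
  next
    fix p q assume pq: "p \<in> carrier ?R" "q \<in> carrier ?R" and "p \<otimes>\<^bsub>?R\<^esub> q \<in> monomial_span ?U"
    then have prod: "p * q \<in> monomial_span ?U"
      by (simp add: mpoly_ring_ops)
    obtain p0 where p0: "Poly_Mapping.keys p0 = Poly_Mapping.keys p - ?U" "p - p0 \<in> monomial_span ?U"
      by (rule split_by_exponents)
    obtain q0 where q0: "Poly_Mapping.keys q0 = Poly_Mapping.keys q - ?U" "q - q0 \<in> monomial_span ?U"
      by (rule split_by_exponents)
    have U_mult: "a * b \<in> monomial_span ?U"
      if "a \<in> monomial_span ?U" "b \<in> monomial_span (exponents n)" for a b :: "'k mpoly"
      using monomial_span_mult[OF that] monomial_span_subset_iff[of "?U + exponents n" ?U] Ucl by blast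
    have q0ex: "q0 \<in> monomial_span (exponents n)" and pex: "p \<in> monomial_span (exponents n)"
      using pq q0 by (auto simp: carrier_mpoly_ring monomial_span_def)
    have "p0 * q0 = p * q - (q - q0) * p - (p - p0) * q0"
      by (simp add: algebra_simps)
    then have in_U: "p0 * q0 \<in> monomial_span ?U"
      using prod U_mult[OF q0(2) pex] U_mult[OF p0(2) q0ex] by (auto intro!: monomial_span_diff)
    have "m \<notin> ?U" if m: "m \<in> Poly_Mapping.keys (p0 * q0)" for m
    proof -
      obtain a b where ab: "m = a + b" "a \<in> Poly_Mapping.keys p0" "b \<in> Poly_Mapping.keys q0"
        using m Poly_Mapping.keys_mult[of p0 q0] by blast
      then have "a \<in> exponents n - ?U" "b \<in> exponents n - ?U"
        using p0(1) q0(1) pq unfolding carrier_mpoly_ring monomial_span_def by blast+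
      then show ?thesis
        by (auto simp: weight_ge_def weight_add ab(1))
    qed
    with in_U have "Poly_Mapping.keys (p0 * q0) = {}"
      unfolding monomial_span_def by blast
    then have "p0 = 0 \<or> q0 = 0"
      by simp
    then show "p \<in> monomial_span ?U \<or> q \<in> monomial_span ?U"
      using p0(2) q0(2) by auto
  qed
  then show ?thesis
    using S by (auto simp: monomial_prime_iff variable_ideal_eq)
qed

section \<open>Monomials in powers of an edge ideal\<close>

definition edge_multiples :: "nat \<Rightarrow> nat set set \<Rightarrow> (nat \<Rightarrow>\<^sub>0 nat) set" where
  "edge_multiples n E = {m \<in> exponents n. \<exists>e\<in>E. \<forall>i\<in>e. 1 \<le> expo m i}"

definition exponent_vector :: "nat set \<Rightarrow> (nat \<Rightarrow> nat) \<Rightarrow> (nat \<Rightarrow>\<^sub>0 nat)" where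
  "exponent_vector A f = (\<Sum>i\<in>A. Poly_Mapping.single i (f i))"

lemma expo_exponent_vector:
  "finite A \<Longrightarrow> expo (exponent_vector A f) i = (if i \<in> A then f i else 0)"
  by (simp add: exponent_vector_def lookup_sum lookup_single when_def)

lemma exponent_vector_in_exponents:
  "A \<subseteq> {1..n} \<Longrightarrow> exponent_vector A f \<in> exponents n"
  using finite_subset[of A "{1..n}"]
  by (auto simp: exponents_def in_keys_iff expo_exponent_vector split: if_splits)

lemma weight_exponent_vector:
  "finite A \<Longrightarrow> finite S \<Longrightarrow> weight S (exponent_vector A f) = 
    (\<Sum>i\<in>A. if i \<in> S then f i else 0)"
  by (simp add: weight_def expo_exponent_vector Int_commute flip: sum.inter_restrict)

lemma simple_graph_edgeD:
  assumes "simple_graph V E" "{i, j} \<in> E"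
  shows "i \<noteq> j" "i \<in> V" "j \<in> V"
proof -
  have "{i, j} \<subseteq> V" "card {i, j} = 2"
    using assms unfolding simple_graph_def by blast+
  then show "i \<noteq> j" "i \<in> V" "j \<in> V"
    by auto
qed

lemma simple_graph_edge_pair:
  assumes "simple_graph V E" "e \<in> E"
  obtains i j where "e = {i, j}" "i \<noteq> j"
proof -
  have "card e = 2"
    using assms unfolding simple_graph_def by blast
  then show thesis
    using that unfolding card_2_iff by blast
qed

lemma simple_graph_edge_at:
  assumes "simple_graph V E" "e \<in> E" "i \<in> e"
  obtains j where "e = {i, j}" "i \<noteq> j"
proof -
  obtain a b where ab: "e = {a, b}" "a \<noteq> b"
    using simple_graph_edge_pair[OF assms(1,2)] .
  with assms(3) have "i = a \<or> i = b"
    by blast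
  then show thesis
  proof
    assume "i = a"
    with ab show thesis by (intro that[of b]) simp_all
  next
    assume "i = b"
    with ab show thesis by (intro that[of a]) (simp_all add: insert_commute)
  qed
qed

lemma edge_ideal_eq:
  assumes G: "simple_graph {1..n} E"
  shows "edge_ideal n E = (monomial_span (edge_multiples n E) :: 'k::field mpoly set)"
proof -
  let ?d = "\<lambda>i j. Poly_Mapping.single i (1::nat) + Poly_Mapping.single j 1"
  let ?M = "{?d i j | i j. {i, j} \<in> E}"
  have M: "?M \<subseteq> exponents n"
  proof clarify
    fix i j assume "{i, j} \<in> E"
    from simple_graph_edgeD[OF G this] show "?d i j \<in> exponents n"
      by (intro exponents_add) (simp_all add: exponents_def)
  qed
  have "?M + exponents n = edge_multiples n E"
  proof
    show "?M + exponents n \<subseteq> edge_multiples n E"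
    proof
      fix m assume "m \<in> ?M + exponents n"
      then obtain i j c where ij: "{i, j} \<in> E" "c \<in> exponents n" "m = ?d i j + c"
        by (auto simp: set_plus_def)
      have "?d i j \<in> exponents n"
        using M ij(1) by blast
      then have "m \<in> exponents n"
        unfolding ij(3) using ij(2) by (rule exponents_add)
      moreover have "\<forall>l\<in>{i, j}. 1 \<le> expo m l"
        using ij by (auto simp: lookup_add)
      ultimately show "m \<in> edge_multiples n E"
        using ij(1) unfolding edge_multiples_def by blast
    qed
    show "edge_multiples n E \<subseteq> ?M + exponents n"
    proof
      fix m assume m: "m \<in> edge_multiples n E"
      then obtain e where e: "e \<in> E" "\<forall>i\<in>e. 1 \<le> expo m i" and mn: "m \<in> exponents n"
        by (auto simp: edge_multiples_def)
      obtain i j where ij: "e = {i, j}" "i \<noteq> j"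
        using simple_graph_edge_pair[OF G e(1)] .
      obtain c where "m = ?d i j + c" "c \<in> exponents n"
        using mn by (rule peel_monomial[where d = "?d i j"])
          (use e ij in \<open>auto simp: lookup_single lookup_add when_def\<close>)
      then show "m \<in> ?M + exponents n"
        using e ij by (auto simp: set_plus_def)
    qed
  qed
  moreover have "{var i * var j | i j. {i, j} \<in> E} = (monom ` ?M :: 'k mpoly set)"
    by (auto simp: var_def monom_def mult_single)
  ultimately show ?thesis
    by (simp only: edge_ideal_def genideal_monom[OF M])
qed

lemma edge_multiples_subset: "edge_multiples n E \<subseteq> exponents n"
  by (auto simp: edge_multiples_def)

lemma edge_ideal_power:
  assumes "simple_graph {1..n} E"
  shows "edge_ideal n E [^]\<^bsub>ideals_set (mpoly_ring n)\<^esub> (k::nat) =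
    monomial_span (sumset_power n (edge_multiples n E) k)"
  by (simp only: edge_ideal_eq[OF assms] monomial_span_power)

text \<open>A product of \<open>k\<close> edges dividing \<open>m\<close> uses only edges inside the support of \<open>m\<close>, and each of
  them contributes to the weight on \<open>S\<close> the number of its endpoints in \<open>S\<close>.  Besides giving the
  containment of a power of the edge ideal in powers of monomial primes, the restriction to the
  support of \<open>m\<close> is what certifies that a monomial lies outside the power.\<close>

lemma weight_of_edge_product:
  assumes "m \<in> sumset_power n (edge_multiples n E) k" "finite S"
    and "\<And>e. e \<in> E \<Longrightarrow> e \<subseteq> Poly_Mapping.keys m \<Longrightarrow> d \<le> card (e \<inter> S)"
  shows "k * d \<le> weight S m"
  using assms
proof (induction k arbitrary: m)
  case 0
  then show ?case by simp
next
  case (Suc k)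
  from Suc.prems(1) obtain a b where ab: "m = a + b"
      "a \<in> sumset_power n (edge_multiples n E) k" "b \<in> edge_multiples n E"
    by (auto simp: set_plus_def)
  then obtain e where e: "e \<in> E" "\<forall>i\<in>e. 1 \<le> expo b i"
    by (auto simp: edge_multiples_def)
  have sub: "Poly_Mapping.keys a \<subseteq> Poly_Mapping.keys m" "e \<subseteq> Poly_Mapping.keys m"
    using e ab by (auto simp: in_keys_iff lookup_add)
  have "k * d \<le> weight S a"
    using Suc.IH ab Suc.prems sub by blast
  moreover have "d \<le> weight S b"
  proof -
    have "d \<le> (\<Sum>i\<in>e \<inter> S. 1)"
      using Suc.prems(3) e sub by simp
    also have "\<dots> \<le> (\<Sum>i\<in>e \<inter> S. expo b i)"
      using e by (intro sum_mono) auto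
    also have "\<dots> \<le> weight S b"
      unfolding weight_def using Suc.prems(2) by (intro sum_mono2) auto
    finally show ?thesis .
  qed
  ultimately show ?case
    by (simp add: ab weight_add)
qed

lemma edge_square_memI:
  assumes G: "simple_graph {1..n} E" and ef: "e \<in> E" "f \<in> E" and m: "m \<in> exponents n"
    and le: "\<And>i. of_bool (i \<in> e) + of_bool (i \<in> f) \<le> expo m i"
  shows "m \<in> sumset_power n (edge_multiples n E) 2"
proof -
  have e: "e \<subseteq> {1..n}"
    using G ef by (simp add: simple_graph_def)
  then have fin: "finite e"
    using finite_subset by blast
  let ?d = "exponent_vector e (\<lambda>_. 1)"
  have d: "expo ?d i = of_bool (i \<in> e)" for i
    using fin by (simp add: expo_exponent_vector)
  have "expo ?d i \<le> expo m i" for i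
    using le[of i] unfolding d by simp
  with m obtain c where c: "m = ?d + c" "c \<in> exponents n" "?d \<in> exponents n"
    using peel_monomial by metis
  have "1 \<le> expo c i" if "i \<in> f" for i
    using le[of i] that unfolding c(1) lookup_add d by simp
  then have "c \<in> edge_multiples n E" "?d \<in> edge_multiples n E"
    using c d ef by (auto simp: edge_multiples_def)
  moreover have "0 \<in> exponents n"
    by (simp add: exponents_def)
  ultimately have "0 + ?d + c \<in> exponents n + edge_multiples n E + edge_multiples n E"
    by (intro set_plus_intro)
  then show ?thesis
    by (simp add: numeral_2_eq_2 c)
qed

lemma edge_power_mem:
  assumes G: "simple_graph {1..n} E" and e: "e \<in> E"
  shows "exponent_vector e (\<lambda>_. k) \<in> sumset_power n (edge_multiples n E) k"
proof (induction k)
  case 0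
  show ?case
    using G e by (simp add: simple_graph_def exponent_vector_in_exponents)
next
  case (Suc k)
  have sub: "e \<subseteq> {1..n}"
    using G e by (simp add: simple_graph_def)
  then have fin: "finite e"
    using finite_subset by blast
  have "exponent_vector e (\<lambda>_. 1) \<in> edge_multiples n E"
    using e sub fin by (auto simp: edge_multiples_def expo_exponent_vector exponent_vector_in_exponents)
  moreover have "exponent_vector e (\<lambda>_. Suc k) =
      exponent_vector e (\<lambda>_. k) + exponent_vector e (\<lambda>_. 1)"
    using fin by (intro poly_mapping_eqI) (simp add: lookup_add expo_exponent_vector)
  ultimately show ?case
    using Suc by (auto simp: set_plus_def)
qed

section \<open>Triangles\<close>

definition undominated_triangle :: "nat set set \<Rightarrow> nat \<Rightarrow> nat \<Rightarrow> nat \<Rightarrow> nat \<Rightarrow> bool" where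
  "undominated_triangle E x y z v \<longleftrightarrow> {x, y} \<in> E \<and> {y, z} \<in> E \<and> {x, z} \<in> E \<and>
     v \<in> \<Union>E - {x, y, z} \<and> {v, x} \<notin> E \<and> {v, y} \<notin> E \<and> {v, z} \<notin> E"

text \<open>The exponents equal to \<open>1\<close> drive the argument: if \<open>m\<close> is not divisible by a product of two
  edges, then any two edges inside its support meet, a vertex shared by two distinct ones has
  exponent \<open>1\<close>, and so does an endpoint of each of them.  The complement of the support together with a vertex of exponent \<open>1\<close> has weight
  \<open>1\<close>, so it is no vertex cover, and some edge inside the support avoids that vertex.  This forces
  the edges inside the support to contain a triangle of total weight \<open>3\<close>; the weight \<open>4\<close> then
  provides a further vertex, whose edge to the triangle is disjoint from the opposite side.\<close>

lemma edge_square_mem_of_weights: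
  assumes G: "simple_graph {1..n} E"
    and dom: "\<And>x y z v. \<not> undominated_triangle E x y z v"
    and m: "m \<in> exponents n"
    and cover: "\<And>C. C \<subseteq> {1..n} \<Longrightarrow> \<forall>e\<in>E. e \<inter> C \<noteq> {} \<Longrightarrow> 2 \<le> weight C m"
    and four: "4 \<le> weight (\<Union>E) m"
  shows "m \<in> sumset_power n (edge_multiples n E) 2"
proof (rule ccontr)
  assume notin: "m \<notin> sumset_power n (edge_multiples n E) 2"
  define W where "W = Poly_Mapping.keys m"
  have W: "i \<in> W \<longleftrightarrow> 1 \<le> expo m i" for i
    by (auto simp: W_def in_keys_iff)
  have no: "\<exists>i. \<not> of_bool (i \<in> e) + of_bool (i \<in> f) \<le> expo m i" if "e \<in> E" "f \<in> E" for e f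
    using edge_square_memI[OF G that m] notin by blast
  have disjoint: False if "e \<in> E" "f \<in> E" "e \<subseteq> W" "f \<subseteq> W" "e \<inter> f = {}" for e f
    using no[of e f] that W by (fastforce simp: of_bool_def split: if_splits)
  have shared: "expo m x = 1"
    if xy: "{x, y} \<in> E" "{x, z} \<in> E" and "y \<noteq> z" and sub: "{x, y, z} \<subseteq> W" for x y z
  proof -
    have "x \<noteq> y" "x \<noteq> z"
      using simple_graph_edgeD[OF G] xy by blast+
    obtain i where "\<not> of_bool (i \<in> {x, y}) + of_bool (i \<in> {x, z}) \<le> expo m i"
      using no xy by blast
    then have "expo m x < 2"
      using W sub \<open>x \<noteq> y\<close> \<open>x \<noteq> z\<close> \<open>y \<noteq> z\<close> by (auto simp: of_bool_def split: if_splits)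
    then show ?thesis
      using W sub by force
  qed
  have repeated: "expo m x = 1 \<or> expo m y = 1" if xy: "{x, y} \<in> E" "{x, y} \<subseteq> W" for x y
  proof -
    obtain i where "\<not> of_bool (i \<in> {x, y}) + of_bool (i \<in> {x, y}) \<le> expo m i"
      using no xy by blast
    then have "expo m x < 2 \<or> expo m y < 2"
      by (auto simp: of_bool_def split: if_splits)
    then show ?thesis
      using W xy by force
  qed
  have uncovered: "\<exists>e\<in>E. e \<subseteq> W \<and> e \<inter> A = {}" if "A \<subseteq> W" "weight A m < 2" for A
  proof (rule ccontr)
    assume *: "\<not> ?thesis"
    let ?C = "({1..n} - W) \<union> A"
    have Wn: "W \<subseteq> {1..n}"
      using m by (simp add: W_def exponents_def)
    have "e \<inter> ?C \<noteq> {}" if "e \<in> E" for e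
    proof -
      have "e \<subseteq> {1..n}"
        using G that by (simp add: simple_graph_def)
      then show ?thesis using * that by blast
    qed
    then have "2 \<le> weight ?C m"
      using Wn \<open>A \<subseteq> W\<close> by (intro cover) auto
    also have "weight ?C m = weight A m"
      unfolding weight_def
      by (rule sum.mono_neutral_right) (use Wn \<open>A \<subseteq> W\<close> W finite_subset[OF \<open>A \<subseteq> W\<close>] in \<open>auto simp: W_def in_keys_iff\<close>)
    finally show False using that by simp
  qed
  have avoid: "\<exists>e\<in>E. e \<subseteq> W \<and> x \<notin> e" if "x \<in> W" "expo m x = 1" for x
    using uncovered[of "{x}"] that by (auto simp: weight_def)
  obtain e where e: "e \<in> E" "e \<subseteq> W"
    using uncovered[of "{}"] by (auto simp: weight_def)
  obtain x y where xy: "e = {x, y}" "expo m x = 1"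
  proof -
    obtain a b where ab: "e = {a, b}"
      using simple_graph_edge_pair[OF G e(1)] by metis
    show thesis
      using repeated[of a b] e ab that[of a b] that[of b a] by blast
  qed
  have xyE: "{x, y} \<in> E" "x \<noteq> y" "x \<in> W" "y \<in> W"
    using e xy simple_graph_edgeD(1)[OF G, of x y] by auto
  obtain f where f: "f \<in> E" "f \<subseteq> W" "x \<notin> f"
    using avoid xy xyE by blast
  obtain z where z: "f = {y, z}"
  proof -
    have "y \<in> f"
      using disjoint[of e f] e f xy by blast
    then show thesis
      using simple_graph_edge_at[OF G f(1)] that by blast
  qed
  have yz: "{y, z} \<in> E" "y \<noteq> z" "z \<in> W" "x \<noteq> z"
    using f z simple_graph_edgeD[OF G, of y z] by auto
  have y1: "expo m y = 1"
    using shared[of y x z] xyE yz by (auto simp: insert_commute)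
  obtain g where g: "g \<in> E" "g \<subseteq> W" "y \<notin> g"
    using avoid[of y] y1 xyE by blast
  have "x \<in> g" "z \<in> g"
    using disjoint[of e g] disjoint[of f g] e f g xy z by auto
  then have "g = {x, z}"
    using simple_graph_edge_at[OF G g(1) \<open>x \<in> g\<close>] yz(4) by auto
  then have xz: "{x, z} \<in> E"
    using g by simp
  have z1: "expo m z = 1"
    using shared[of z x y] xyE yz xz by (auto simp: insert_commute)
  have "\<exists>v\<in>\<Union>E. v \<notin> {x, y, z} \<and> v \<in> W"
  proof (rule ccontr)
    assume *: "\<not> ?thesis"
    have "\<Union>E \<subseteq> {1..n}"
      using G by (auto simp: simple_graph_def)
    then have fin: "finite (\<Union>E)"
      using finite_subset by blast
    have "expo m i = 0" if "i \<in> \<Union>E - {x, y, z}" for i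
      using * that W[of i] by force
    moreover have "{x, y, z} \<subseteq> \<Union>E"
      using xyE(1) yz(1) by blast
    ultimately have "weight (\<Union>E) m = weight {x, y, z} m"
      unfolding weight_def using fin by (intro sum.mono_neutral_right) blast+
    also have "\<dots> = 3"
      using xy y1 z1 xyE yz by (simp add: weight_def)
    finally show False using four by simp
  qed
  then obtain v where v: "v \<in> \<Union>E" "v \<notin> {x, y, z}" "v \<in> W"
    by blast
  have "\<not> undominated_triangle E x y z v"
    by (rule dom)
  then consider "{v, x} \<in> E" | "{v, y} \<in> E" | "{v, z} \<in> E"
    using v xyE yz xz by (auto simp: undominated_triangle_def)
  then show False
  proof cases
    case 1
    then show ?thesis using disjoint[of "{v, x}" "{y, z}"] v xyE yz by auto
  next
    case 2
    then show ?thesis using disjoint[of "{v, y}" "{x, z}"] v xyE yz xz by auto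
  next
    case 3
    then show ?thesis using disjoint[of "{v, z}" "{x, y}"] v xyE yz by auto
  qed
qed

text \<open>The weight conditions for vertex covers alone describe the second symbolic power of the edge
  ideal, which contains the product of the vertices of every triangle.  That product has degree
  \<open>3\<close>, and the fourth power of the ideal of all non-isolated vertices is there to exclude it.\<close>

lemma intersection_type_square_of_no_undominated_triangle:
  fixes E :: "nat set set"
  assumes G: "simple_graph {1..n} E"
    and dom: "\<And>x y z v. \<not> undominated_triangle E x y z v"
  shows "intersection_type n
    ((edge_ideal n E :: 'k::field mpoly set) [^]\<^bsub>ideals_set (mpoly_ring n)\<^esub> (2::nat))"
    (is "intersection_type n ?J")
proof -
  let ?U = "sumset_power n (edge_multiples n E) 2"
  define covers where "covers = {C. C \<subseteq> {1..n} \<and> (\<forall>e\<in>E. e \<inter> C \<noteq> {})}"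
  define D where "D = insert (\<Union>E, 4) ((\<lambda>C. (C, 2::nat)) ` covers)"
  define F :: "('k mpoly set \<times> nat) set" where "F = (\<lambda>(S, a). (variable_ideal n S, a)) ` D"
  have J: "?J = monomial_span ?U"
    using G by (rule edge_ideal_power)
  have Uex: "?U \<subseteq> exponents n"
    by (intro sumset_power_subset edge_multiples_subset)
  have E: "\<Union>E \<subseteq> {1..n}"
    using G by (auto simp: simple_graph_def)
  have "finite covers"
    unfolding covers_def by simp
  then have F: "finite F" "F \<noteq> {}"
    by (auto simp: F_def D_def)
  have D: "S \<subseteq> {1..n}" "1 \<le> a" if "(S, a) \<in> D" for S a
    using that E by (auto simp: D_def covers_def)
  have "?U = (\<Inter>(S, a)\<in>D. weight_ge n S a)"
  proof
    show "?U \<subseteq> (\<Inter>(S, a)\<in>D. weight_ge n S a)"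
    proof clarify
      fix m S a assume m: "m \<in> ?U" and "(S, a) \<in> D"
      then consider "S = \<Union>E" "a = 4" | "S \<in> covers" "a = 2"
        by (auto simp: D_def)
      then have "a \<le> weight S m"
      proof cases
        case 1
        have "2 \<le> card (e \<inter> \<Union>E)" if "e \<in> E" for e
        proof -
          have "e \<inter> \<Union>E = e" using that by blast
          then show ?thesis using G that by (simp add: simple_graph_def)
        qed
        then show ?thesis
          using weight_of_edge_product[OF m, of "\<Union>E" 2] 1 finite_subset[OF E] by simp
      next
        case 2
        then have fin: "finite S"
          using finite_subset[of S "{1..n}"] by (simp add: covers_def)
        then have "1 \<le> card (e \<inter> S)" if "e \<in> E" for e
          using 2 that by (simp add: covers_def Suc_le_eq card_gt_0_iff)
        then show ?thesis
          using weight_of_edge_product[OF m fin, of 1] 2 by simp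
      qed
      then show "m \<in> weight_ge n S a"
        using m Uex by (auto simp: weight_ge_def)
    qed
    show "(\<Inter>(S, a)\<in>D. weight_ge n S a) \<subseteq> ?U"
    proof
      fix m assume "m \<in> (\<Inter>(S, a)\<in>D. weight_ge n S a)"
      then have *: "m \<in> weight_ge n S a" if "(S, a) \<in> D" for S a
        using that by blast
      show "m \<in> ?U"
        using *[of "\<Union>E" 4] *[of _ 2]
        by (intro edge_square_mem_of_weights[OF G dom])
          (auto simp: D_def covers_def weight_ge_def)
    qed
  qed
  then have "?J = (\<Inter>(S, a)\<in>D. monomial_span (weight_ge n S a))"
    unfolding J by (auto simp: monomial_span_def)
  also have "\<dots> = (\<Inter>(S, a)\<in>D. variable_ideal n S [^]\<^bsub>ideals_set (mpoly_ring n)\<^esub> a)"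
    using D by (intro INF_cong) (auto simp: variable_ideal_power)
  also have "\<dots> = (\<Inter>(P, a)\<in>F. P [^]\<^bsub>ideals_set (mpoly_ring n)\<^esub> a)"
    by (simp add: F_def image_image case_prod_unfold)
  finally have "?J = (\<Inter>(P, a)\<in>F. P [^]\<^bsub>ideals_set (mpoly_ring n)\<^esub> a)" .
  moreover have "\<forall>(P, a)\<in>F. monomial_prime n P \<and> a \<ge> 1"
    using D by (auto simp: F_def monomial_prime_variable_ideal)
  moreover have "monomial_ideal n ?J"
  proof -
    let ?M = "edge_multiples n E + edge_multiples n E"
    have M: "?M \<subseteq> exponents n"
      using edge_multiples_subset by (auto simp: set_plus_def intro!: exponents_add)
    have "?U = ?M + exponents n"
      by (simp add: numeral_2_eq_2 add.commute add.left_commute)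
    then have "?J = genideal (mpoly_ring n) (monom ` ?M)"
      by (simp only: J genideal_monom[OF M])
    then show ?thesis
      using M by (auto simp: monomial_ideal_def exponents_def)
  qed
  ultimately show ?thesis
    using F unfolding intersection_type_def by blast
qed

text \<open>The set \<open>S\<close> of a prime whose power contains \<open>I\<^sup>k\<close> meets every edge.  If \<open>S\<close> misses
  one of \<open>x\<close>, \<open>y\<close>, \<open>z\<close>, \<open>v\<close>, some edge meets it once, so the exponent is at most \<open>k\<close>, and
  two vertices of the triangle already give \<open>u\<close> the weight \<open>k\<close>; otherwise the exponent is at most
  \<open>2 k\<close>, which is the degree of \<open>u\<close>.\<close>

lemma not_intersection_type_power_of_undominated_triangle:
  fixes E :: "nat set set"
  assumes G: "simple_graph {1..n} E" and T: "undominated_triangle E x y z v" and k: "k \<ge> 2"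
  shows "\<not> intersection_type n
    ((edge_ideal n E :: 'k::field mpoly set) [^]\<^bsub>ideals_set (mpoly_ring n)\<^esub> (k::nat))"
    (is "\<not> intersection_type n ?J")
proof
  assume "intersection_type n ?J"
  then obtain F where F: "\<forall>(P, a)\<in>F. monomial_prime n P \<and> a \<ge> 1"
      and JF: "?J = (\<Inter>(P, a)\<in>F. P [^]\<^bsub>ideals_set (mpoly_ring n)\<^esub> (a::nat))"
    unfolding intersection_type_def by blast
  let ?U = "sumset_power n (edge_multiples n E) k"
  have J: "?J = monomial_span ?U"
    using G by (rule edge_ideal_power)
  have E: "{x, y} \<in> E" "{y, z} \<in> E" "{x, z} \<in> E" and v: "v \<notin> {x, y, z}"
    using T by (auto simp: undominated_triangle_def)
  obtain w where w: "{v, w} \<in> E"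
  proof -
    obtain e where "e \<in> E" "v \<in> e"
      using T by (auto simp: undominated_triangle_def)
    then show thesis
      using simple_graph_edge_at[OF G] that by blast
  qed
  have distinct: "x \<noteq> y" "y \<noteq> z" "x \<noteq> z" "v \<noteq> w" "x \<noteq> v" "y \<noteq> v" "z \<noteq> v"
    using simple_graph_edgeD(1)[OF G] E v w by blast+
  have "{x, y, z, v} \<subseteq> {1..n}"
    using simple_graph_edgeD(2,3)[OF G] E w by blast
  \<comment> \<open>The monomial \<open>x y z v (x y)\<^bsup>k-2\<^esup>\<close>.\<close>
  define u where "u = exponent_vector {x, y, z, v} (\<lambda>i. if i \<in> {x, y} then k - 1 else 1)"
  have u: "u \<in> exponents n"
    unfolding u_def by (rule exponent_vector_in_exponents) fact
  have u_mem: "u \<in> weight_ge n S a" if a: "1 \<le> a" "S \<subseteq> {1..n}" and US: "?U \<subseteq> weight_ge n S a" for S a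
  proof -
    have fin: "finite S"
      using a finite_subset by blast
    \<comment> \<open>The \<open>k\<close>-th power of an edge lies in \<open>I\<^sup>k\<close>, so its weight on \<open>S\<close> bounds \<open>a\<close>.\<close>
    have edge: "a \<le> k * (of_bool (i \<in> S) + of_bool (j \<in> S))" if ij: "{i, j} \<in> E" for i j
    proof -
      have "i \<noteq> j"
        using simple_graph_edgeD[OF G ij] by simp
      have "a \<le> weight S (exponent_vector {i, j} (\<lambda>_. k))"
        using edge_power_mem[OF G ij, of k] US by (auto simp: weight_ge_def)
      also have "\<dots> = (\<Sum>l\<in>{i, j}. if l \<in> S then k else 0)"
        using fin by (subst weight_exponent_vector) simp_all
      also have "\<dots> = k * (of_bool (i \<in> S) + of_bool (j \<in> S))"
        using \<open>i \<noteq> j\<close> by (simp add: of_bool_def)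
      finally show ?thesis .
    qed
    have "weight S u =
        (\<Sum>i\<in>{x, y, z, v}. if i \<in> S then (if i \<in> {x, y} then k - 1 else 1) else 0)"
      unfolding u_def using fin
      by (subst weight_exponent_vector) simp_all
    also have "\<dots> = (k - 1) * of_bool (x \<in> S) + (k - 1) * of_bool (y \<in> S) + of_bool (z \<in> S)
        + of_bool (v \<in> S)"
      using distinct by (simp add: of_bool_def)
    finally have "a \<le> weight S u"
      using edge[OF E(1)] edge[OF E(2)] edge[OF E(3)] edge[OF w] k a(1)
      by (cases "x \<in> S"; cases "y \<in> S"; cases "z \<in> S"; cases "v \<in> S"; cases "w \<in> S"; simp)
    then show ?thesis
      using u by (simp add: weight_ge_def)
  qed
  have "monom u \<in> P [^]\<^bsub>ideals_set (mpoly_ring n)\<^esub> a" if Pa: "(P, a) \<in> F" for P a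
  proof -
    obtain S where S: "P = variable_ideal n S" "S \<subseteq> {1..n}" and a: "1 \<le> a"
      using F Pa by (auto simp: monomial_prime_iff)
    have P: "P [^]\<^bsub>ideals_set (mpoly_ring n)\<^esub> a = monomial_span (weight_ge n S a)"
      using variable_ideal_power S by blast
    have "?J \<subseteq> P [^]\<^bsub>ideals_set (mpoly_ring n)\<^esub> a"
      unfolding JF using Pa by blast
    then have "?U \<subseteq> weight_ge n S a"
      by (simp only: J P monomial_span_subset_iff)
    with a S show ?thesis
      unfolding P monom_def by (intro single_in_monomial_span u_mem)
  qed
  then have "monom u \<in> ?J"
    unfolding JF by blast
  then have "u \<in> ?U"
    by (simp add: J monom_def monomial_span_def)
  then have "k * 2 \<le> weight {x, y, z} u"
  proof (rule weight_of_edge_product)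
    fix e assume e: "e \<in> E" "e \<subseteq> Poly_Mapping.keys u"
    have keys: "Poly_Mapping.keys u \<subseteq> {x, y, z, v}"
      by (auto simp: u_def in_keys_iff expo_exponent_vector split: if_splits)
    have "v \<notin> e"
    proof
      assume "v \<in> e"
      then obtain i where "e = {v, i}" "v \<noteq> i"
        using simple_graph_edge_at[OF G e(1)] by blast
      then show False
        using T e keys by (auto simp: undominated_triangle_def)
    qed
    then have "e \<inter> {x, y, z} = e"
      using e keys by blast
    then show "2 \<le> card (e \<inter> {x, y, z})"
      using G e by (simp add: simple_graph_def)
  qed simp
  moreover have "weight {x, y, z} u = 2 * (k - 1) + 1"
    using distinct by (simp add: u_def weight_def expo_exponent_vector)
  ultimately show False using k by simp
qed

theorem corollary2p13:
  fixes n k :: nat and E :: "nat set set" and I :: "'k::field mpoly set"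
  assumes "simple_graph {1..n} E"
    and "I = edge_ideal n E"
    and "\<not> intersection_type n (I [^]\<^bsub>ideals_set (mpoly_ring n)\<^esub> (2::nat))"
    and "k \<ge> 2"
  shows "\<not> intersection_type n (I [^]\<^bsub>ideals_set (mpoly_ring n)\<^esub> k)"
proof -
  obtain x y z v where "undominated_triangle E x y z v"
    using intersection_type_square_of_no_undominated_triangle[OF assms(1)] assms(2,3) by blast
  then show ?thesis
    using not_intersection_type_power_of_undominated_triangle assms by blast
qed

end
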